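(* Let $F$ be a number field with ring of integers $O_F$, $\overline{\mathbb{Z}}$ the ring of all algebraic integers (containing $O_F$), and $\mathcal{J}=O_F\alpha$ a non-zero principal ideal of $O_F$. Let $t\in O_F$ be prime to $\mathcal{J}$ (i.e. $\mathcal{J}+tO_F=O_F$). Suppose $x_0,y_0\in O_F$ satisfy $x_0+ty_0\equiv0\pmod{\mathcal{J}}$ and $|x_0\cdot y_0|_v\le|\alpha|_v/2$ for all archimedean places $v$ of $F$, and that $x_0$, $y_0$ and $\alpha$ are pairwise relatively prime, in the sense that the ideal of $O_F$ generated by any two of them is $O_F$. Then there is no non-zero pair $(x,y)\in\overline{\mathbb{Z}}\times\overline{\mathbb{Z}}$ such that (1) $x+ty\equiv0\pmod{\mathcal{J}\overline{\mathbb{Z}}}$, and (2) for all embeddings $\lambda:\overline{\mathbb{Z}}\to\mathbb{C}$ one has $|\lambda(x)|\le|\lambda(x_0)|$ and $|\lambda(y)|\le|\lambda(y_0)|$, with at least one of these inequalities being strict for at least one $\lambda$.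
   Context: For an archimedean place $v$ of $F$, $|\cdot|_v$ denotes the usual Euclidean absolute value on the completion $F_v\subseteq\mathbb{C}$. *)

theory Defs
  imports Complex_Main "HOL-Algebra.Algebraic_Closure_Type"
begin

text \<open>
  Number fields are rendered as subfields of an arbitrary algebraically closed field \<open>'a\<close> of
  characteristic 0, and the ring of all algebraic integers is taken inside \<open>'a\<close>, so that it
  contains the ring of integers of every number field in \<open>'a\<close>. Every number field arises in
  this way, for instance inside the complex numbers or inside its own algebraic closure.
\<close>

definition number_field :: "'a::field_char_0 set \<Rightarrow> bool" where
  "number_field F \<longleftrightarrow> subfield F (ring_of_type_algebra :: 'a ring) \<and>
     ring.finite_dimension (ring_of_type_algebra :: 'a ring) \<rat> F"

definition algebraic_integers :: "'a::field_char_0 ring" where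
  "algebraic_integers = ring_of_type_algebra\<lparr>carrier := {x. algebraic_int x}\<rparr>"

definition ring_of_integers :: "'a::field_char_0 set \<Rightarrow> 'a ring" where
  "ring_of_integers F = ring_of_type_algebra\<lparr>carrier := {x \<in> F. algebraic_int x}\<rparr>"

definition complex_embeddings :: "'a ring \<Rightarrow> ('a \<Rightarrow> complex) set" where
  "complex_embeddings R =
     {\<sigma> \<in> ring_hom R (ring_of_type_algebra :: complex ring). inj_on \<sigma> (carrier R)}"

definition absolute_value :: "'a::field set \<Rightarrow> ('a \<Rightarrow> real) \<Rightarrow> bool" where
  "absolute_value F w \<longleftrightarrow>
     (\<forall>x\<in>F. 0 \<le> w x \<and> (w x = 0 \<longleftrightarrow> x = 0)) \<and>
     (\<forall>x\<in>F. \<forall>y\<in>F. w (x * y) = w x * w y \<and> w (x + y) \<le> w x + w y)"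

definition archimedean :: "'a::field set \<Rightarrow> ('a \<Rightarrow> real) \<Rightarrow> bool" where
  "archimedean F w \<longleftrightarrow> \<not> (\<forall>x\<in>F. \<forall>y\<in>F. w (x + y) \<le> max (w x) (w y))"

definition equivalent_abs :: "'a set \<Rightarrow> ('a \<Rightarrow> real) \<Rightarrow> ('a \<Rightarrow> real) \<Rightarrow> bool" where
  "equivalent_abs F w w' \<longleftrightarrow> (\<exists>s>0. \<forall>x\<in>F. w' x = w x powr s)"

definition archimedean_places :: "'a::field set \<Rightarrow> ('a \<Rightarrow> real) set set" where
  "archimedean_places F =
     {{w'. absolute_value F w' \<and> equivalent_abs F w w'} | w. absolute_value F w \<and> archimedean F w}"

text \<open>
  The completion of \<open>F\<close> at an archimedean place \<open>v\<close> is the closure in the complex numbers of the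
  image of an embedding \<open>\<sigma>\<close> of \<open>F\<close> that induces \<open>v\<close>, and the Euclidean absolute value on it
  restricts to \<open>x \<mapsto> cmod (\<sigma> x)\<close> on \<open>F\<close>. Such a \<open>\<sigma>\<close> exists by Ostrowski's theorem. Two choices
  give the same function on \<open>F\<close>: they could differ only by an exponent, which the value at 2
  forces to be 1.
\<close>

definition place_embedding :: "'a::field set \<Rightarrow> ('a \<Rightarrow> real) set \<Rightarrow> 'a \<Rightarrow> complex" where
  "place_embedding F v =
     (SOME \<sigma>. \<sigma> \<in> complex_embeddings (ring_of_type_algebra\<lparr>carrier := F\<rparr>) \<and> (\<lambda>x. cmod (\<sigma> x)) \<in> v)"

definition place_abs :: "'a::field set \<Rightarrow> ('a \<Rightarrow> real) set \<Rightarrow> 'a \<Rightarrow> real" where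
  "place_abs F v x = cmod (place_embedding F v x)"

end

theory Submission
  imports Defs "Jordan_Normal_Form.Char_Poly"
begin

text \<open>
  The determinant \<open>x y0 - x0 y\<close> vanishes modulo \<open>\<alpha>\<close>, say it is \<open>\<alpha> z\<close>, and its absolute value under
  every embedding is at most \<open>2 |x0 y0| \<le> |\<alpha>|\<close>. So all conjugates of the algebraic integer \<open>z\<close> have
  absolute value at most 1, and one of them less than 1 (if \<open>x0 y0 \<noteq> 0\<close>); looking at the norm,
  \<open>z = 0\<close>. Since \<open>x0\<close> and \<open>y0\<close> are coprime, \<open>(x, y) = (x0 e, y0 e)\<close> for an algebraic integer \<open>e\<close>,
  and the norm argument applied to \<open>e\<close> gives \<open>e = 0\<close>. The norm argument needs every root of the
  minimal polynomial of \<open>z\<close> to come from an embedding of the whole ring of algebraic integers;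
  such embeddings are maximal elements, by Zorn's lemma, among the graphs of embeddings of subrings.
\<close>

subsection \<open>Sums and products of algebraic integers\<close>

text \<open>With the integers acting by multiplication, \<open>int_mod.span B\<close> is the
  additive group generated by \<open>B\<close>; integrality is read off from finitely generated
  groups of this kind.\<close>

interpretation int_mod: Modules.module "\<lambda>(n::int) (x::'a::comm_ring_1). of_int n * x"
  by unfold_locales (auto simp: algebra_simps)

text \<open>Multiplication by \<open>z\<close> on the span has an integer matrix, and \<open>z\<close> is a root of its
  characteristic polynomial.\<close>

lemma algebraic_intI_int_span:
  fixes z :: "'a::field_char_0"
  assumes fin: "finite B" and ne: "\<exists>b\<in>B. b \<noteq> 0"
    and stable: "\<And>b. b \<in> B \<Longrightarrow> z * b \<in> int_mod.span B"
  shows "algebraic_int z"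
proof -
  define N where "N = card B"
  obtain e where e: "bij_betw e {..<N} B"
    using ex_bij_betw_nat_finite[OF fin] unfolding N_def atLeast0LessThan by blast
  have "\<forall>b\<in>B. \<exists>c. z * b = (\<Sum>v\<in>B. of_int (c v) * v)"
    using stable int_mod.span_finite[OF fin] by blast
  then obtain c where c: "\<And>b. b \<in> B \<Longrightarrow> z * b = (\<Sum>v\<in>B. of_int (c b v) * v)"
    by metis
  define A where "A = mat N N (\<lambda>(i, j). c (e i) (e j))"
  define A' :: "'a mat" where "A' = map_mat of_int A"
  have A: "A \<in> carrier_mat N N" and A': "A' \<in> carrier_mat N N"
    by (simp_all add: A_def A'_def)
  have eB: "e i \<in> B" if "i < N" for i
    using e that by (auto dest: bij_betwE)
  \<comment> \<open>Row \<open>i\<close> of \<open>A'\<close> lists the coefficients of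
    \<open>z * e i\<close>, and \<open>ne\<close> makes the vector of generators nonzero.\<close>
  have "eigenvector A' (vec N e) z"
    unfolding eigenvector_def
  proof (intro conjI)
    obtain i where "i < N" "e i \<noteq> 0"
      using ne e unfolding bij_betw_def by (metis imageE lessThan_iff)
    then show "vec N e \<noteq> 0\<^sub>v (dim_row A')"
      using A' by (metis carrier_matD(1) index_vec index_zero_vec(1))
    show "A' *\<^sub>v vec N e = z \<cdot>\<^sub>v vec N e"
    proof (rule eq_vecI)
      fix i assume "i < dim_vec (z \<cdot>\<^sub>v vec N e)"
      then have i: "i < N" by simp
      have "(A' *\<^sub>v vec N e) $ i = (\<Sum>j<N. of_int (c (e i) (e j)) * e j)"
        using i by (simp add: A'_def A_def scalar_prod_def atLeast0LessThan)
      also have "\<dots> = (\<Sum>v\<in>B. of_int (c (e i) v) * v)"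
        using sum.reindex_bij_betw[OF e, of "\<lambda>v. of_int (c (e i) v) * v"] by simp
      finally show "(A' *\<^sub>v vec N e) $ i = (z \<cdot>\<^sub>v vec N e) $ i"
        using c[OF eB[OF i]] i by simp
    qed (use A' in simp)
  qed (use A' in simp)
  then have "poly (char_poly A') z = 0"
    using eigenvalue_root_char_poly[OF A'] unfolding eigenvalue_def by blast
  moreover have "char_poly A' = map_poly of_int (char_poly A)"
    unfolding A'_def by (rule of_int_hom.char_poly_hom[OF A])
  moreover have "lead_coeff (char_poly A) = 1"
    using degree_monic_char_poly[OF A] by metis
  ultimately show ?thesis
    by (auto simp: algebraic_int_altdef_ipoly)
qed

text \<open>Multiplication by \<open>z\<close> is additive, so stability passes from the generators
  to the group. This allows two stable multiplications to be composed.\<close>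

lemma int_span_mult:
  assumes "\<And>b. b \<in> B \<Longrightarrow> z * b \<in> int_mod.span B" and "v \<in> int_mod.span B"
  shows "z * v \<in> int_mod.span B"
  using assms(2)
proof (induction rule: int_mod.span_induct_alt)
  case base
  then show ?case by (simp add: int_mod.span_zero)
next
  case (step c x y)
  have "of_int c * (z * x) + z * y \<in> int_mod.span B"
    by (intro int_mod.span_add int_mod.span_scale assms(1) step)
  then show ?case by (simp add: algebra_simps)
qed

text \<open>The monic equation rewrites the top power of \<open>x\<close> as an integer combination
  of lower ones. The factor \<open>w\<close> stands for a power of a second algebraic
  integer.\<close>

lemma monic_power_in_int_span:
  fixes x :: "'a::field_char_0"
  assumes "lead_coeff p = 1" and "\<forall>i. coeff p i \<in> \<int>" and "poly p x = 0"
    and "\<And>i. i < degree p \<Longrightarrow> x ^ i * w \<in> int_mod.span B"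
  shows "x ^ degree p * w \<in> int_mod.span B"
proof -
  have "0 = (\<Sum>i<degree p. coeff p i * x ^ i) + x ^ degree p"
    using assms(1,3) by (simp add: poly_altdef lessThan_Suc_atMost[symmetric])
  then have "x ^ degree p * w = - (\<Sum>i<degree p. coeff p i * x ^ i) * w"
    by (metis eq_neg_iff_add_eq_0 add.commute)
  also have "\<dots> = - (\<Sum>i<degree p. coeff p i * (x ^ i * w))"
    by (simp add: sum_distrib_right mult.assoc)
  also have "\<dots> \<in> int_mod.span B"
  proof (intro int_mod.span_neg int_mod.span_sum)
    fix i assume "i \<in> {..<degree p}"
    moreover obtain n where "coeff p i = of_int n"
      using assms(2) by (metis Ints_cases)
    ultimately show "coeff p i * (x ^ i * w) \<in> int_mod.span B"
      using int_mod.span_scale[OF assms(4), of i n] by simp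
  qed
  finally show ?thesis .
qed

text \<open>The monomials in \<open>x\<close> and \<open>y\<close> with exponents below the degrees
  of two monic equations generate a group stable under both multiplications.\<close>

lemma algebraic_int_common_int_span:
  fixes x y :: "'a::field_char_0"
  assumes "algebraic_int x" and "algebraic_int y"
  obtains B where "finite B" "\<exists>b\<in>B. b \<noteq> 0"
    "\<And>b. b \<in> B \<Longrightarrow> x * b \<in> int_mod.span B" "\<And>b. b \<in> B \<Longrightarrow> y * b \<in> int_mod.span B"
proof -
  obtain p where p: "lead_coeff p = 1" "\<forall>i. coeff p i \<in> \<int>" "poly p x = 0"
    using assms(1) by (auto simp: algebraic_int.simps)
  obtain q where q: "lead_coeff q = 1" "\<forall>i. coeff q i \<in> \<int>" "poly q y = 0"
    using assms(2) by (auto simp: algebraic_int.simps)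
  define B where "B = (\<lambda>(i, j). x ^ i * y ^ j) ` ({..<degree p} \<times> {..<degree q})"
  have in_B: "x ^ i * y ^ j \<in> int_mod.span B" if "i < degree p" "j < degree q" for i j
    using that by (intro int_mod.span_base) (auto simp: B_def)
  have pos: "degree r > 0" if "lead_coeff r = 1" "poly r c = 0" for r :: "'a poly" and c
    using that by (intro gr0I) (auto elim!: degree_eq_zeroE)
  show thesis
  proof
    show "finite B" by (simp add: B_def)
    have "1 \<in> B"
      unfolding B_def using pos[OF p(1,3)] pos[OF q(1,3)] by (intro image_eqI[of _ _ "(0, 0)"]) auto
    then show "\<exists>b\<in>B. b \<noteq> 0" using zero_neq_one by metis
  next
    fix b assume "b \<in> B"
    then obtain i j where ij: "i < degree p" "j < degree q" and b: "b = x ^ i * y ^ j"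
      by (auto simp: B_def)
    \<comment> \<open>Either \<open>Suc i < degree p\<close> and this is a generator, or
      \<open>Suc i = degree p\<close> and the monic equation lowers the exponent.\<close>
    have "x ^ Suc i * y ^ j \<in> int_mod.span B"
      using monic_power_in_int_span[OF p, of "y ^ j" B] in_B ij by (metis Suc_lessI)
    then show "x * b \<in> int_mod.span B" by (simp add: b mult.assoc)
    have "y ^ Suc j * x ^ i \<in> int_mod.span B"
      using monic_power_in_int_span[OF q, of "x ^ i" B] in_B ij by (metis Suc_lessI mult.commute)
    then show "y * b \<in> int_mod.span B" by (simp add: b ac_simps)
  qed
qed

lemma algebraic_int_add [intro]:
  fixes x y :: "'a::field_char_0"
  assumes "algebraic_int x" and "algebraic_int y"
  shows "algebraic_int (x + y)"
proof -
  obtain B where B: "finite B" "\<exists>b\<in>B. b \<noteq> 0"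
    "\<And>b. b \<in> B \<Longrightarrow> x * b \<in> int_mod.span B" "\<And>b. b \<in> B \<Longrightarrow> y * b \<in> int_mod.span B"
    using algebraic_int_common_int_span[OF assms] by blast
  show ?thesis
    using B by (intro algebraic_intI_int_span[of B]) (auto simp: distrib_right intro: int_mod.span_add)
qed

lemma algebraic_int_mult [intro]:
  fixes x y :: "'a::field_char_0"
  assumes "algebraic_int x" and "algebraic_int y"
  shows "algebraic_int (x * y)"
proof -
  obtain B where B: "finite B" "\<exists>b\<in>B. b \<noteq> 0"
    "\<And>b. b \<in> B \<Longrightarrow> x * b \<in> int_mod.span B" "\<And>b. b \<in> B \<Longrightarrow> y * b \<in> int_mod.span B"
    using algebraic_int_common_int_span[OF assms] by blast
  show ?thesis
  proof (rule algebraic_intI_int_span[OF B(1,2)])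
    show "x * y * b \<in> int_mod.span B" if "b \<in> B" for b
      using int_span_mult[OF B(3) B(4)[OF that]] by (simp add: mult.assoc)
  qed
qed

lemma algebraic_int_prod_mset:
  fixes A :: "'a::field_char_0 multiset"
  shows "(\<And>x. x \<in># A \<Longrightarrow> algebraic_int x) \<Longrightarrow> algebraic_int (prod_mset A)"
  by (induction A) auto

subsection \<open>Extension of embeddings\<close>

text \<open>\<open>G\<close> is the graph of a ring homomorphism from a subring of the algebraic integers to the
  complex numbers.\<close>

locale partial_embedding =
  fixes G :: "('a::field_char_0 \<times> complex) set"
  assumes one_mem: "(1, 1) \<in> G"
    and add_mem: "(a, b) \<in> G \<Longrightarrow> (c, d) \<in> G \<Longrightarrow> (a + c, b + d) \<in> G"
    and mult_mem: "(a, b) \<in> G \<Longrightarrow> (c, d) \<in> G \<Longrightarrow> (a * c, b * d) \<in> G"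
    and minus_mem: "(a, b) \<in> G \<Longrightarrow> (- a, - b) \<in> G"
    and integral: "(a, b) \<in> G \<Longrightarrow> algebraic_int a"
    and functional: "(0, b) \<in> G \<Longrightarrow> b = 0"
begin

lemma zero_mem: "(0, 0) \<in> G"
  using add_mem[OF one_mem minus_mem[OF one_mem]] by simp

text \<open>Subtracting the two pairs leaves a pair over 0, which is why \<open>functional\<close>
  speaks of 0 only.\<close>

lemma single_valued: "(a, b) \<in> G \<Longrightarrow> (a, c) \<in> G \<Longrightarrow> b = c"
  using functional[of "b - c"] add_mem[of a b "- a" "- c"] minus_mem[of a c] by simp

lemma of_nat_mem: "(of_nat n, of_nat n) \<in> G"
proof (induction n)
  case 0
  show ?case using zero_mem by simp
next
  case (Suc n)
  then show ?case using add_mem[OF one_mem Suc] by simp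
qed

lemma of_int_mem: "(of_int n, of_int n) \<in> G"
proof (cases n)
  case (nonneg m)
  then show ?thesis using of_nat_mem[of m] by simp
next
  case (neg m)
  then show ?thesis using minus_mem[OF of_nat_mem[of "Suc m"]] by simp
qed

lemma sum_mem: "(\<And>i. i \<in> A \<Longrightarrow> (f i, g i) \<in> G) \<Longrightarrow> (sum f A, sum g A) \<in> G"
  by (induction A rule: infinite_finite_induct) (auto simp: zero_mem intro: add_mem)

text \<open>Since \<open>G\<close> is a relation, the coefficientwise image of a polynomial is a
  relation too: \<open>q\<close> is \<open>p\<close> with the homomorphism applied to its
  coefficients.\<close>

definition lifts :: "'a poly \<Rightarrow> complex poly \<Rightarrow> bool" where
  "lifts p q \<longleftrightarrow> (\<forall>i. (coeff p i, coeff q i) \<in> G)"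

lemma lifts_add: "lifts p q \<Longrightarrow> lifts r s \<Longrightarrow> lifts (p + r) (q + s)"
  by (simp add: lifts_def add_mem)

lemma lifts_minus: "lifts p q \<Longrightarrow> lifts (- p) (- q)"
  by (simp add: lifts_def minus_mem)

lemma lifts_diff: "lifts p q \<Longrightarrow> lifts r s \<Longrightarrow> lifts (p - r) (q - s)"
  using lifts_add[of p q "- r" "- s"] lifts_minus[of r s] by simp

lemma lifts_mult: "lifts p q \<Longrightarrow> lifts r s \<Longrightarrow> lifts (p * r) (q * s)"
  unfolding lifts_def coeff_mult by (intro allI sum_mem mult_mem) auto

lemma lifts_monom: "(a, b) \<in> G \<Longrightarrow> lifts (monom a n) (monom b n)"
  by (simp add: lifts_def zero_mem)

lemma lifts_smult: "(a, b) \<in> G \<Longrightarrow> lifts p q \<Longrightarrow> lifts (smult a p) (smult b q)"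
  by (simp add: lifts_def mult_mem)

lemma lifts_of_int_poly: "lifts (map_poly of_int h) (map_poly of_int h)"
  by (simp add: lifts_def coeff_map_poly of_int_mem)

lemma lifts_0: "lifts 0 q \<Longrightarrow> q = 0"
  by (auto simp: lifts_def poly_eq_iff intro: functional)

lemma poly_mem: "lifts p q \<Longrightarrow> (a, b) \<in> G \<Longrightarrow> (poly p a, poly q b) \<in> G"
proof (induction p arbitrary: q)
  case 0
  then show ?case using lifts_0 zero_mem by fastforce
next
  case (pCons c p)
  obtain d s where q: "q = pCons d s"
    by (cases q)
  have *: "(coeff (pCons c p) i, coeff (pCons d s) i) \<in> G" for i
    using pCons.prems(1) by (simp add: lifts_def q)
  have "(c, d) \<in> G"
    using *[of 0] by simp
  moreover have "lifts p s"
    unfolding lifts_def using *[of "Suc _"] by simp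
  ultimately show ?case
    using pCons.IH pCons.prems(2) by (auto simp: q intro: add_mem mult_mem)
qed

text \<open>If \<open>(a, 0)\<close> lay in \<open>G\<close> with \<open>a \<noteq> 0\<close>, an integer polynomial \<open>h\<close> of least degree vanishing
  at \<open>a\<close> would have a nonzero constant term, which is the value assigned to \<open>h a = 0\<close>.\<close>

lemma injective:
  assumes "(a, 0) \<in> G"
  shows "a = 0"
proof (rule ccontr)
  assume "a \<noteq> 0"
  let ?P = "\<lambda>h. h \<noteq> 0 \<and> poly (map_poly of_int h) a = 0"
  obtain h0 where "poly (map_poly of_int h0) a = 0" "lead_coeff h0 = 1"
    using integral[OF assms] by (auto simp: algebraic_int_altdef_ipoly)
  then have "?P h0" by auto
  then obtain h where h: "?P h" and least: "\<And>h'. ?P h' \<Longrightarrow> degree h \<le> degree h'"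
    using ex_has_least_nat[of ?P h0 degree] by blast
  obtain c g where hcg: "h = pCons c g"
    by (cases h)
  have "(0, poly (map_poly of_int h) 0) \<in> G"
    using poly_mem[OF lifts_of_int_poly assms, of h] h by simp
  from functional[OF this] have "c = 0"
    by (simp add: hcg map_poly_pCons)
  then have "?P g"
    using h \<open>a \<noteq> 0\<close> by (auto simp: hcg map_poly_pCons)
  then show False
    using least[of g] by (simp add: hcg)
qed

text \<open>For \<open>p\<close> of least degree, pseudo-division by \<open>p\<close> shows that \<open>a \<mapsto> r\<close> is well defined for every
  root \<open>r\<close> of \<open>q\<close>; no inverses in \<open>G\<close> are needed.\<close>

lemma minimal_lift:
  assumes "algebraic_int a"
  obtains p q where "lifts p q" "poly p a = 0" "degree q > 0"
    "\<And>r f g. poly q r = 0 \<Longrightarrow> lifts f g \<Longrightarrow> poly f a = 0 \<Longrightarrow> poly g r = 0"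
proof -
  let ?P = "\<lambda>p. p \<noteq> 0 \<and> poly p a = 0 \<and> (\<exists>q. lifts p q)"
  obtain h where "poly (map_poly of_int h) a = 0" "lead_coeff h = 1"
    using assms by (auto simp: algebraic_int_altdef_ipoly)
  then have "?P (map_poly of_int h)"
    using lifts_of_int_poly by (auto simp: map_poly_eq_0_iff)
  then obtain p where p: "?P p" and least: "\<And>p'. ?P p' \<Longrightarrow> degree p \<le> degree p'"
    using ex_has_least_nat[of ?P _ degree] by blast
  then obtain q where pq: "lifts p q" by blast
  define c d where "c = lead_coeff p" and "d = coeff q (degree p)"
  have cd: "(c, d) \<in> G"
    using pq by (simp add: lifts_def c_def d_def)
  \<comment> \<open>By injectivity the image of the nonzero \<open>c\<close> is nonzero. So
    \<open>q\<close> is not constant, and \<open>d\<close> can be cancelled at the end.\<close>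
  have "d \<noteq> 0"
    using injective[of c] cd p by (auto simp: c_def)
  have deg_pos: "degree f > 0" if "f \<noteq> 0" "poly f a = 0" for f
    using that by (intro gr0I) (auto elim!: degree_eq_zeroE)
  have "degree q \<ge> degree p"
    using \<open>d \<noteq> 0\<close> by (simp add: d_def le_degree)
  moreover have "degree p > 0"
    using deg_pos p by blast
  ultimately have "degree q > 0" by simp
  have kernel: "poly g r = 0" if "poly q r = 0" "lifts f g" "poly f a = 0" for r f g
    using that(2,3)
  proof (induction "degree f" arbitrary: f g rule: less_induct)
    case less
    show ?case
    proof (cases "f = 0")
      case True
      then show ?thesis using less.prems(1) lifts_0 by (metis poly_0)
    next
      case False
      \<comment> \<open>Minimality of \<open>degree p\<close> makes this difference of natural
        numbers exact.\<close>
      define k where "k = degree f - degree p"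
      have deg: "degree f = degree p + k"
        using least[of f] False less.prems unfolding k_def by fastforce
      \<comment> \<open>Scaling \<open>f\<close> by \<open>c\<close> lets the leading terms cancel
        without division.\<close>
      define f' where "f' = smult c f - monom (lead_coeff f) k * p"
      \<comment> \<open>The same operation on the image side. The coefficient is taken at
        \<open>degree f\<close> because there it is paired in \<open>G\<close> with
        \<open>lead_coeff f\<close>.\<close>
      define g' where "g' = smult d g - monom (coeff g (degree f)) k * q"
      have "lifts f' g'"
        unfolding f'_def g'_def
        using less by (intro lifts_diff lifts_smult lifts_mult lifts_monom cd pq) (auto simp: lifts_def)
      moreover have root: "poly f' a = 0"
        using less p by (simp add: f'_def)
      moreover have "degree f' < degree f"
      proof -
        have "degree f' \<le> degree f"
          unfolding f'_def
          by (intro degree_diff_le order_trans[OF degree_smult_le] order_trans[OF degree_mult_le])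
             (auto simp: deg degree_monom_le)
        moreover have "coeff f' (degree f) = 0"
          by (simp add: f'_def coeff_monom_mult deg c_def)
        \<comment> \<open>Equal degrees would force \<open>f' = 0\<close>, so \<open>f\<close> would
          have degree 0, contrary to \<open>deg_pos\<close>.\<close>
        ultimately show ?thesis
          using deg_pos[OF False] less.prems
          by (metis degree_0 leading_coeff_0_iff le_neq_implies_less)
      qed
      ultimately have "poly g' r = 0"
        by (intro less.hyps[of f' g'])
      \<comment> \<open>At \<open>r\<close> the multiple of \<open>q\<close> drops out, so
        \<open>poly g' r\<close> is \<open>d * poly g r\<close>.\<close>
      then show ?thesis
        using that(1) \<open>d \<noteq> 0\<close> by (simp add: g'_def)
    qed
  qed
  show thesis
    using that[of p q] pq p \<open>degree q > 0\<close> kernel by blast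
qed

text \<open>If \<open>A\<close> is the domain of \<open>G\<close>, this is the candidate graph on
  \<open>A[a]\<close> sending \<open>a\<close> to \<open>r\<close>. A priori it is only a
  relation.\<close>

definition adjoin :: "'a \<Rightarrow> complex \<Rightarrow> ('a \<times> complex) set" where
  "adjoin a r = {(poly f a, poly g r) | f g. lifts f g}"

lemma adjoinI: "lifts f g \<Longrightarrow> (poly f a, poly g r) \<in> adjoin a r"
  by (auto simp: adjoin_def)

lemma adjoin_superset: "G \<subseteq> adjoin a r"
proof (clarify)
  fix b c assume "(b, c) \<in> G"
  from adjoinI[OF lifts_monom[OF this, of 0], of a r] show "(b, c) \<in> adjoin a r"
    by (simp add: poly_monom)
qed

lemma adjoin_generator: "(a, r) \<in> adjoin a r"
  using adjoinI[OF lifts_monom[OF one_mem, of 1], of a r] by (simp add: poly_monom)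

lemma algebraic_int_poly:
  assumes "algebraic_int a" and "lifts f g"
  shows "algebraic_int (poly f a)"
  using assms(2)
proof (induction f arbitrary: g)
  case (pCons c f)
  obtain d s where g: "g = pCons d s"
    by (cases g)
  have *: "(coeff (pCons c f) i, coeff (pCons d s) i) \<in> G" for i
    using pCons.prems by (simp add: lifts_def g)
  have "algebraic_int c"
    using *[of 0] integral by simp
  moreover have "lifts f s"
    unfolding lifts_def using *[of "Suc _"] by simp
  ultimately show ?case
    using pCons.IH assms(1) by auto
qed simp

text \<open>Closure comes from the ring operations on polynomials; \<open>kernel\<close> says
  exactly that 0 receives no value other than 0.\<close>

lemma partial_embedding_adjoin:
  assumes a: "algebraic_int a"
    and kernel: "\<And>f g. lifts f g \<Longrightarrow> poly f a = 0 \<Longrightarrow> poly g r = 0"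
  shows "partial_embedding (adjoin a r)"
proof
  show "(1, 1) \<in> adjoin a r"
    using one_mem adjoin_superset by blast
next
  fix b c d e assume "(b, c) \<in> adjoin a r" "(d, e) \<in> adjoin a r"
  then obtain f g f' g' where fg: "lifts f g" "b = poly f a" "c = poly g r"
      and fg': "lifts f' g'" "d = poly f' a" "e = poly g' r"
    by (auto simp: adjoin_def)
  show "(b + d, c + e) \<in> adjoin a r"
    using adjoinI[OF lifts_add[OF fg(1) fg'(1)], of a r] fg fg' by simp
  show "(b * d, c * e) \<in> adjoin a r"
    using adjoinI[OF lifts_mult[OF fg(1) fg'(1)], of a r] fg fg' by simp
next
  fix b c assume "(b, c) \<in> adjoin a r"
  then obtain f g where fg: "lifts f g" "b = poly f a" "c = poly g r"
    by (auto simp: adjoin_def)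
  show "(- b, - c) \<in> adjoin a r"
    using adjoinI[OF lifts_minus[OF fg(1)], of a r] fg by simp
  show "algebraic_int b"
    using algebraic_int_poly[OF a fg(1)] fg(2) by simp
next
  fix c assume "(0, c) \<in> adjoin a r"
  then show "c = 0"
    using kernel by (auto simp: adjoin_def)
qed

end

text \<open>The starting point for conjugates over the integers; characteristic 0 makes the relation
  functional.\<close>

lemma partial_embedding_of_int:
  "partial_embedding (range (\<lambda>n. (of_int n :: 'a::field_char_0, of_int n)))"
proof
  fix a c :: 'a and b d :: complex
  assume "(a, b) \<in> range (\<lambda>n. (of_int n, of_int n))" "(c, d) \<in> range (\<lambda>n. (of_int n, of_int n))"
  then obtain n m where "a = of_int n" "b = of_int n" "c = of_int m" "d = of_int m"
    by auto
  then show "(a + c, b + d) \<in> range (\<lambda>n. (of_int n, of_int n))"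
    and "(a * c, b * d) \<in> range (\<lambda>n. (of_int n, of_int n))"
    by (auto simp flip: of_int_add of_int_mult)
next
  fix a :: 'a and b :: complex
  assume "(a, b) \<in> range (\<lambda>n. (of_int n, of_int n))"
  then obtain n where "a = of_int n" "b = of_int n"
    by auto
  then show "(- a, - b) \<in> range (\<lambda>n. (of_int n, of_int n))" and "algebraic_int a"
    by (auto simp flip: of_int_minus)
qed (auto intro: range_eqI[of _ _ 1])

text \<open>Each axiom involves at most two pairs, and any two pairs lie in a common member of the
  chain.\<close>

lemma partial_embedding_Union_chain:
  assumes "C \<noteq> {}" and "\<And>G. G \<in> C \<Longrightarrow> partial_embedding G"
    and chain: "\<And>G H. G \<in> C \<Longrightarrow> H \<in> C \<Longrightarrow> G \<subseteq> H \<or> H \<subseteq> G"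
  shows "partial_embedding (\<Union>C)"
proof
  show "(1, 1) \<in> \<Union>C"
    using assms(1,2) partial_embedding.one_mem by blast
next
  fix a b c d assume "(a, b) \<in> \<Union>C" "(c, d) \<in> \<Union>C"
  then obtain G where "G \<in> C" "(a, b) \<in> G" "(c, d) \<in> G"
    using chain by blast
  then show "(a + c, b + d) \<in> \<Union>C" and "(a * c, b * d) \<in> \<Union>C"
    using assms(2) partial_embedding.add_mem partial_embedding.mult_mem by blast+
next
  fix a b assume "(a, b) \<in> \<Union>C"
  then show "(- a, - b) \<in> \<Union>C" and "algebraic_int a"
    using assms(2) partial_embedding.minus_mem partial_embedding.integral by blast+
next
  fix b assume "(0, b) \<in> \<Union>C"
  then show "b = 0"
    using assms(2) partial_embedding.functional by blast
qed

lemma maximal_partial_embedding: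
  assumes "partial_embedding G"
  obtains M where "partial_embedding M" "G \<subseteq> M"
    "\<And>H. partial_embedding H \<Longrightarrow> M \<subseteq> H \<Longrightarrow> H = M"
proof -
  define A where "A = {H. partial_embedding H \<and> G \<subseteq> H}"
  have "\<exists>M\<in>A. \<forall>H\<in>A. M \<subseteq> H \<longrightarrow> H = M"
  proof (rule subset_Zorn_nonempty)
    show "A \<noteq> {}" using assms by (auto simp: A_def)
  next
    fix C assume C: "C \<noteq> {}" "subset.chain A C"
    then have "partial_embedding (\<Union>C)"
      by (intro partial_embedding_Union_chain) (auto simp: subset_chain_def A_def)
    moreover obtain H where "H \<in> C" "G \<subseteq> H"
      using C by (auto simp: subset_chain_def A_def)
    moreover from this have "G \<subseteq> \<Union>C" by auto
    ultimately show "\<Union>C \<in> A"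
      by (simp only: A_def mem_Collect_eq simp_thms)
  qed
  then obtain M where "M \<in> A" "\<And>H. H \<in> A \<Longrightarrow> M \<subseteq> H \<Longrightarrow> H = M"
    by blast
  then show thesis
    by (intro that[of M]) (auto simp: A_def)
qed

text \<open>A maximal extension is total: for any algebraic integer \<open>a\<close>, the lifted
  minimal polynomial has a complex root \<open>r\<close>, and adjoining \<open>a\<close> with value
  \<open>r\<close> cannot enlarge the graph.\<close>

lemma extend_partial_embedding:
  assumes "partial_embedding G"
  shows "\<exists>\<tau>\<in>complex_embeddings algebraic_integers. \<forall>a b. (a, b) \<in> G \<longrightarrow> \<tau> a = b"
proof -
  obtain M where M: "partial_embedding M" "G \<subseteq> M"
    and max: "\<And>H. partial_embedding H \<Longrightarrow> M \<subseteq> H \<Longrightarrow> H = M"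
    using maximal_partial_embedding[OF assms] by blast
  interpret partial_embedding M by fact
  have total: "\<exists>b. (a, b) \<in> M" if a: "algebraic_int a" for a
  proof -
    obtain p q where "lifts p q" "poly p a = 0" "degree q > 0"
      and kernel: "\<And>r f g. poly q r = 0 \<Longrightarrow> lifts f g \<Longrightarrow> poly f a = 0 \<Longrightarrow> poly g r = 0"
      by (rule minimal_lift[OF a]) blast
    then obtain r where r: "poly q r = 0"
      using fundamental_theorem_of_algebra[of q] constant_degree[of q] by auto
    have "adjoin a r = M"
      by (rule max[OF partial_embedding_adjoin[OF a kernel[OF r]] adjoin_superset])
    then show ?thesis
      using adjoin_generator[of a r] by blast
  qed
  define \<tau> where "\<tau> a = (SOME b. (a, b) \<in> M)" for a
  have \<tau>: "(a, \<tau> a) \<in> M" if "algebraic_int a" for a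
    unfolding \<tau>_def using total[OF that] by (rule someI_ex)
  have \<tau>_eq: "\<tau> a = b" if "(a, b) \<in> M" for a b
    by (rule single_valued[OF \<tau>[OF integral[OF that]] that])
  have "\<tau> \<in> Ring.ring_hom algebraic_integers ring_of_type_algebra"
    unfolding algebraic_integers_def ring_of_type_algebra_def
    by (rule ring_hom_memI) (simp_all add: \<tau>_eq one_mem add_mem mult_mem \<tau>)
  moreover have "inj_on \<tau> (carrier algebraic_integers)"
  proof (rule inj_onI)
    fix a b :: 'a
    assume "a \<in> carrier algebraic_integers" "b \<in> carrier algebraic_integers" "\<tau> a = \<tau> b"
    then have "(a, \<tau> b) \<in> M" "(- b, - \<tau> b) \<in> M"
      using \<tau>[of a] minus_mem[OF \<tau>, of b] by (simp_all add: algebraic_integers_def)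
    then show "a = b"
      using injective[of "a - b"] add_mem[of a "\<tau> b" "- b" "- \<tau> b"] by simp
  qed
  ultimately have "\<tau> \<in> complex_embeddings algebraic_integers"
    unfolding complex_embeddings_def by (simp only: mem_Collect_eq simp_thms)
  moreover have "\<tau> a = b" if "(a, b) \<in> G" for a b
    using subsetD[OF M(2) that] by (rule \<tau>_eq)
  ultimately show ?thesis
    by blast
qed

subsection \<open>Conjugates of algebraic integers\<close>

lemma complex_embedding_hom:
  assumes "\<tau> \<in> complex_embeddings (ring_of_type_algebra\<lparr>carrier := A\<rparr>)" and "a \<in> A" "b \<in> A"
  shows "\<tau> (a + b) = \<tau> a + \<tau> b" and "\<tau> (a * b) = \<tau> a * \<tau> b"
    and "\<tau> a = \<tau> b \<longleftrightarrow> a = b"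
  using assms
  by (auto simp: complex_embeddings_def Ring.ring_hom_def ring_of_type_algebra_def inj_on_eq_iff)

lemma complex_embedding_one:
  assumes "\<tau> \<in> complex_embeddings (ring_of_type_algebra\<lparr>carrier := A\<rparr>)"
  shows "\<tau> 1 = 1"
  using assms by (auto simp: complex_embeddings_def Ring.ring_hom_def ring_of_type_algebra_def)

locale integer_embedding =
  fixes \<tau> :: "'a::field_char_0 \<Rightarrow> complex"
  assumes embedding: "\<tau> \<in> complex_embeddings algebraic_integers"
begin

lemma add: "algebraic_int a \<Longrightarrow> algebraic_int b \<Longrightarrow> \<tau> (a + b) = \<tau> a + \<tau> b"
  and mult: "algebraic_int a \<Longrightarrow> algebraic_int b \<Longrightarrow> \<tau> (a * b) = \<tau> a * \<tau> b"
  and eq_iff: "algebraic_int a \<Longrightarrow> algebraic_int b \<Longrightarrow> \<tau> a = \<tau> b \<longleftrightarrow> a = b"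
  using complex_embedding_hom[OF embedding[unfolded algebraic_integers_def], of a b] by auto

lemma zero: "\<tau> 0 = 0"
  using add[of 0 0] by simp

lemma minus: "algebraic_int a \<Longrightarrow> \<tau> (- a) = - \<tau> a"
  using add[of a "- a"] zero by (simp add: eq_neg_iff_add_eq_0 add.commute)

lemma diff: "algebraic_int a \<Longrightarrow> algebraic_int b \<Longrightarrow> \<tau> (a - b) = \<tau> a - \<tau> b"
  using add[of a "- b"] minus[of b] by simp

lemma eq_0_iff: "algebraic_int a \<Longrightarrow> \<tau> a = 0 \<longleftrightarrow> a = 0"
  using eq_iff[of a 0] zero by simp

text \<open>Reading a total embedding as its graph makes the facts about polynomials and integers in
  \<open>partial_embedding\<close> available for it.\<close>

lemma partial_embedding_graph: "partial_embedding {(a, \<tau> a) | a. algebraic_int a}"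
  by unfold_locales
     (auto simp: zero add mult minus
        complex_embedding_one[OF embedding[unfolded algebraic_integers_def]])

lemma of_int: "\<tau> (of_int n) = of_int n"
  using partial_embedding.of_int_mem[OF partial_embedding_graph, of n] by auto

end

section \<open>Algebraic integers with small conjugates\<close>

lemma norm_prod_mset_less_one:
  fixes f :: "'b \<Rightarrow> complex"
  assumes "\<And>x. x \<in># A \<Longrightarrow> cmod (f x) \<le> 1" and "y \<in># A" and "cmod (f y) < 1"
  shows "cmod (\<Prod>x\<in>#A. f x) < 1"
proof -
  obtain B where A: "A = add_mset y B"
    using assms(2) by (metis multi_member_split)
  have "cmod (\<Prod>x\<in>#B. f x) \<le> 1"
    using assms(1) unfolding A
    by (induction B) (auto simp: norm_mult intro!: mult_le_one)
  then have "cmod (f y) * cmod (\<Prod>x\<in>#B. f x) \<le> cmod (f y) * 1"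
    by (intro mult_left_mono) auto
  then show ?thesis
    using assms(3) by (simp add: A norm_mult)
qed

text \<open>The product of the roots of an integer polynomial of least degree vanishing at \<open>z\<close> is a
  rational algebraic integer of absolute value less than 1, so it vanishes. Every root is a
  conjugate of \<open>z\<close>, because the polynomial has least degree.\<close>

lemma algebraic_int_eq_0I:
  fixes z :: "'a::field_char_0"
  assumes z: "algebraic_int z"
    and le: "\<And>\<tau>. \<tau> \<in> complex_embeddings algebraic_integers \<Longrightarrow> cmod (\<tau> z) \<le> 1"
    and less: "\<tau>0 \<in> complex_embeddings algebraic_integers" "cmod (\<tau>0 z) < 1"
  shows "z = 0"
proof -
  let ?G = "range (\<lambda>n. (of_int n :: 'a, of_int n :: complex))"
  interpret G: partial_embedding ?G
    by (rule partial_embedding_of_int)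
  obtain p q where pq: "G.lifts p q" "poly p z = 0" "degree q > 0"
    and kernel: "\<And>r f g. poly q r = 0 \<Longrightarrow> G.lifts f g \<Longrightarrow> poly f z = 0 \<Longrightarrow> poly g r = 0"
    by (rule G.minimal_lift[OF z]) blast
  have q_int: "coeff q i \<in> \<int>" for i
    using pq(1)[unfolded G.lifts_def, rule_format, of i] by auto
  have conj: "\<exists>\<tau>\<in>complex_embeddings algebraic_integers. \<tau> z = r" if "poly q r = 0" for r
  proof -
    have "partial_embedding (G.adjoin z r)"
      by (rule G.partial_embedding_adjoin[OF z]) (rule kernel[OF that])
    from extend_partial_embedding[OF this] show ?thesis
      using G.adjoin_generator[of z r] by blast
  qed
  \<comment> \<open>\<open>q\<close> need not be monic, so integrality of \<open>r\<close> comes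
    from a monic \<open>h\<close> vanishing at \<open>z\<close>: it lifts to itself and hence
    vanishes at \<open>r\<close>.\<close>
  have root_int: "algebraic_int r" if "poly q r = 0" for r
  proof -
    obtain h where "poly (map_poly of_int h) z = 0" "lead_coeff h = 1"
      using z by (auto simp: algebraic_int_altdef_ipoly)
    then show ?thesis
      using kernel[OF that G.lifts_of_int_poly] by (auto simp: algebraic_int_altdef_ipoly)
  qed
  have "q \<noteq> 0"
    using pq(3) by auto
  \<comment> \<open>\<open>p\<close> and \<open>q\<close> are the same integer polynomial over two
    fields, and \<open>\<tau>0\<close> fixes the integers. So the strictly small value occurs among
    the roots of \<open>q\<close>.\<close>
  have root0: "poly q (\<tau>0 z) = 0"
  proof -
    interpret \<tau>0: integer_embedding \<tau>0 by unfold_locales (rule less(1))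
    interpret H: partial_embedding "{(a, \<tau>0 a) | a. algebraic_int a}"
      by (rule \<tau>0.partial_embedding_graph)
    have "H.lifts p q"
      unfolding H.lifts_def
    proof
      fix i
      obtain n where "coeff p i = of_int n" "coeff q i = of_int n"
        using pq(1)[unfolded G.lifts_def, rule_format, of i] by auto
      then show "(coeff p i, coeff q i) \<in> {(a, \<tau>0 a) | a. algebraic_int a}"
        using H.of_int_mem[of n] by simp
    qed
    from H.poly_mem[OF this, of z "\<tau>0 z"] have "(0, poly q (\<tau>0 z)) \<in> {(a, \<tau>0 a) | a. algebraic_int a}"
      using pq(2) z by simp
    then show ?thesis
      by (rule H.functional)
  qed
  define P where "P = (\<Prod>r\<in>#proots q. - r)"
  have "poly q 0 = lead_coeff q * P"
    by (subst complex_poly_decompose_multiset[of q, symmetric])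
       (simp add: P_def poly_prod_mset image_mset.compositionality o_def)
  \<comment> \<open>This gives rationality only; integrality of \<open>P\<close> comes from its
    factors.\<close>
  then have "P = poly q 0 / lead_coeff q"
    using \<open>q \<noteq> 0\<close> by simp
  then have "P \<in> \<rat>"
    using q_int Ints_subset_Rats by (auto simp: poly_0_coeff_0 intro!: Rats_divide)
  moreover have "algebraic_int P"
    unfolding P_def using \<open>q \<noteq> 0\<close> root_int by (intro algebraic_int_prod_mset) auto
  ultimately have "P \<in> \<int>"
    using rational_algebraic_int_is_int by blast
  moreover have "cmod P < 1"
    unfolding P_def
  proof (rule norm_prod_mset_less_one)
    show "\<tau>0 z \<in># proots q"
      using root0 \<open>q \<noteq> 0\<close> by simp
    show "cmod (- r) \<le> 1" if "r \<in># proots q" for r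
      using that conj[of r] le \<open>q \<noteq> 0\<close> by auto
  qed (use less in simp)
  ultimately have "P = 0"
    by (auto elim!: Ints_cases)
  then have "poly q 0 = 0"
    using \<open>poly q 0 = lead_coeff q * P\<close> by simp
  \<comment> \<open>Now 0 is a root of \<open>q\<close>, hence a conjugate of \<open>z\<close>, and
    embeddings are injective.\<close>
  then obtain \<tau> where "\<tau> \<in> complex_embeddings algebraic_integers" "\<tau> z = 0"
    using conj by blast
  then show ?thesis
    using integer_embedding.eq_0_iff[of \<tau> z] z by (simp add: integer_embedding_def)
qed

subsection \<open>Number fields and their archimedean places\<close>

text \<open>Clearing the denominators of a rational combination of generators gives an integer
  combination; each dimension step adds one generator and one denominator.\<close>

lemma dimension_int_span:
  fixes E :: "'a::field_char_0 set"
  assumes "ring.dimension (ring_of_type_algebra :: 'a ring) n \<rat> E"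
  obtains B where "finite B" "B \<subseteq> E" "\<And>f. f \<in> E \<Longrightarrow> \<exists>n>0. of_int n * f \<in> int_mod.span B"
proof -
  interpret R: ring "ring_of_type_algebra :: 'a ring"
    by (rule ring_from_type_algebra)
  \<comment> \<open>Carrying \<open>0 \<in> E\<close> through the induction puts each new
    \<open>v\<close> into its line extension.\<close>
  have "0 \<in> E \<and> (\<exists>B. finite B \<and> B \<subseteq> E \<and> (\<forall>f\<in>E. \<exists>n>0. of_int n * f \<in> int_mod.span B))"
    using assms
  proof (induction n "\<rat> :: 'a set" E rule: R.dimension.induct)
    case zero_dim
    show ?case
      by (auto simp: ring_of_type_algebra_def int_mod.span_zero intro!: exI[of _ "{}"] exI[of _ 1])
  next
    case (Suc_dim v E n)
    then obtain B where zero: "0 \<in> E" and B: "finite B" "B \<subseteq> E"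
      and span: "\<And>f. f \<in> E \<Longrightarrow> \<exists>n>0. of_int n * f \<in> int_mod.span B"
      by blast
    have mem: "f \<in> R.line_extension \<rat> v E \<longleftrightarrow> (\<exists>q\<in>\<rat>. \<exists>e\<in>E. f = q * v + e)" for f
      by (simp add: R.line_extension_mem_iff) (simp add: ring_of_type_algebra_def)
    have "\<exists>n>0. of_int n * f \<in> int_mod.span (insert v B)" if f_mem: "f \<in> R.line_extension \<rat> v E" for f
    proof -
      obtain q e where q: "q \<in> \<rat>" and e: "e \<in> E" and f: "f = q * v + e"
        using f_mem mem by blast
      obtain a b where b: "b > 0" and q': "q = of_int a / of_int b"
        using q by (rule Rats_cases')
      obtain n where n: "n > 0" "of_int n * e \<in> int_mod.span B"
        using span[OF e] by blast
      have sub: "int_mod.span B \<subseteq> int_mod.span (insert v B)"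
        by (intro int_mod.span_mono) auto
      have "of_int (n * a) * v + of_int b * (of_int n * e) \<in> int_mod.span (insert v B)"
        by (rule int_mod.span_add[OF int_mod.span_scale[OF int_mod.span_base[OF insertI1]]
              int_mod.span_scale[OF subsetD[OF sub n(2)]]])
      also have "of_int (n * a) * v + of_int b * (of_int n * e) = of_int (n * b) * f"
        using b by (simp add: f q' distrib_left)
      finally show ?thesis
        using n(1) b by (intro exI[of _ "n * b"]) simp
    qed
    moreover have "0 \<in> R.line_extension \<rat> v E" "insert v B \<subseteq> R.line_extension \<rat> v E"
    proof -
      have "e \<in> R.line_extension \<rat> v E" if "e \<in> E" for e
        using that unfolding mem by (intro bexI[of _ 0] bexI[of _ e]) auto
      moreover have "v \<in> R.line_extension \<rat> v E"
        using zero unfolding mem by (intro bexI[of _ 1] bexI[of _ 0]) auto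
      ultimately show "0 \<in> R.line_extension \<rat> v E" "insert v B \<subseteq> R.line_extension \<rat> v E"
        using zero B by auto
    qed
    ultimately show ?case
      using B(1) by blast
  qed
  then show thesis
    using that by blast
qed

lemma number_field_subring:
  assumes "number_field (F :: 'a::field_char_0 set)"
  shows "1 \<in> F" and "x \<in> F \<Longrightarrow> y \<in> F \<Longrightarrow> x + y \<in> F" and "x \<in> F \<Longrightarrow> y \<in> F \<Longrightarrow> x * y \<in> F"
    and "x \<in> F \<Longrightarrow> - x \<in> F"
proof -
  interpret R: ring "ring_of_type_algebra :: 'a ring"
    by (rule ring_from_type_algebra)
  have F: "subring F (ring_of_type_algebra :: 'a ring)"
    using assms subfieldE(1) by (auto simp: number_field_def)
  show "1 \<in> F" and "x \<in> F \<Longrightarrow> y \<in> F \<Longrightarrow> x + y \<in> F" and "x \<in> F \<Longrightarrow> y \<in> F \<Longrightarrow> x * y \<in> F"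
    using subringE[OF F] by (auto simp: ring_of_type_algebra_def)
  have "\<ominus>\<^bsub>ring_of_type_algebra\<^esub> x = - x"
    by (rule R.minus_equality) (auto simp: ring_of_type_algebra_def)
  then show "x \<in> F \<Longrightarrow> - x \<in> F"
    using subringE(5)[OF F, of x] by simp
qed

lemma number_field_denominator:
  fixes F :: "'a::field_char_0 set"
  assumes F: "number_field F" and x: "x \<in> F"
  shows "\<exists>n>0. algebraic_int (of_int n * x)"
proof -
  interpret R: ring "ring_of_type_algebra :: 'a ring"
    by (rule ring_from_type_algebra)
  obtain B where B: "finite B" "B \<subseteq> F" and span: "\<And>f. f \<in> F \<Longrightarrow> \<exists>n>0. of_int n * f \<in> int_mod.span B"
    using F dimension_int_span unfolding number_field_def R.finite_dimension_def by metis
  have "\<forall>b\<in>B. \<exists>n>0. of_int n * (x * b) \<in> int_mod.span B"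
    using B(2) number_field_subring(3)[OF F x] by (intro ballI span) auto
  then obtain d where d: "\<And>b. b \<in> B \<Longrightarrow> d b > 0 \<and> of_int (d b) * (x * b) \<in> int_mod.span B"
    by metis
  \<comment> \<open>A common multiple of the denominators of all \<open>x * b\<close>, so
    multiplication by \<open>N * x\<close> maps \<open>B\<close> into its span.\<close>
  define N where "N = prod d B"
  have "N > 0"
    unfolding N_def using d by (intro prod_pos) auto
  have "algebraic_int (of_int N * x)"
  proof (rule algebraic_intI_int_span[OF B(1)])
    fix b assume b: "b \<in> B"
    have "of_int (prod d (B - {b})) * (of_int (d b) * (x * b)) \<in> int_mod.span B"
      using int_mod.span_scale[OF conjunct2[OF d[OF b]]] .
    also have "of_int (prod d (B - {b})) * (of_int (d b) * (x * b)) = of_int N * x * b"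
      unfolding N_def prod.remove[OF B(1) b] by simp
    finally show "of_int N * x * b \<in> int_mod.span B" .
  next
    \<comment> \<open>The span of \<open>B\<close> contains a nonzero multiple of 1.\<close>
    show "\<exists>b\<in>B. b \<noteq> 0"
    proof (rule ccontr)
      assume "\<not> (\<exists>b\<in>B. b \<noteq> 0)"
      then have "int_mod.span B \<subseteq> {0}"
        by (auto simp: int_mod.span_finite[OF B(1)] intro!: sum.neutral)
      moreover obtain n where "n > 0" "(of_int n :: 'a) * 1 \<in> int_mod.span B"
        using span[OF number_field_subring(1)[OF F]] by blast
      ultimately show False by auto
    qed
  qed
  then show ?thesis
    using \<open>N > 0\<close> by blast
qed

text \<open>Every element of \<open>F\<close> is an algebraic integer divided by a positive integer,
  and this forces the value of the extension.\<close>

lemma extend_embedding_number_field: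
  fixes F :: "'a::field_char_0 set"
  assumes F: "number_field F" and \<tau>: "\<tau> \<in> complex_embeddings algebraic_integers"
  obtains \<sigma> where "\<sigma> \<in> complex_embeddings (ring_of_type_algebra\<lparr>carrier := F\<rparr>)"
    "\<And>x. algebraic_int x \<Longrightarrow> \<sigma> x = \<tau> x"
proof -
  interpret integer_embedding \<tau> by unfold_locales (rule \<tau>)
  define den where "den x = (SOME n. n > 0 \<and> algebraic_int (of_int n * x))" for x :: 'a
  define \<sigma> where "\<sigma> x = \<tau> (of_int (den x) * x) / of_int (den x)" for x
  \<comment> \<open>The value does not depend on the chosen denominator, so any convenient one may
    be used below.\<close>
  have \<sigma>: "\<sigma> x = \<tau> (of_int n * x) / of_int n" if n: "n > 0" "algebraic_int (of_int n * x)" for n x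
  proof -
    have d: "den x > 0 \<and> algebraic_int (of_int (den x) * x)"
      unfolding den_def using n by (intro someI[of "\<lambda>n. n > 0 \<and> algebraic_int (of_int n * x)" n]) simp
    have "of_int n * \<tau> (of_int (den x) * x) = \<tau> (of_int n * (of_int (den x) * x))"
      using mult[OF algebraic_int_of_int conjunct2[OF d], of n] by (simp only: of_int)
    also have "\<dots> = \<tau> (of_int (den x) * (of_int n * x))"
      by (simp only: mult.left_commute)
    also have "\<dots> = of_int (den x) * \<tau> (of_int n * x)"
      using mult[OF algebraic_int_of_int n(2), of "den x"] by (simp only: of_int)
    finally show ?thesis
      using d n(1) by (simp add: \<sigma>_def frac_eq_eq mult.commute)
  qed
  have hom: "\<sigma> (x + y) = \<sigma> x + \<sigma> y \<and> \<sigma> (x * y) = \<sigma> x * \<sigma> y \<and> (\<sigma> x = \<sigma> y \<longrightarrow> x = y)"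
    if xF: "x \<in> F" and yF: "y \<in> F" for x y
  proof -
    obtain n where n: "n > 0" "algebraic_int (of_int n * x)"
      using number_field_denominator[OF F xF] by blast
    obtain m where m: "m > 0" "algebraic_int (of_int m * y)"
      using number_field_denominator[OF F yF] by blast
    let ?a = "of_int n * x" and ?b = "of_int m * y"
    have nm: "n * m > 0"
      using n m by simp
    \<comment> \<open>\<open>n * m\<close> serves as a denominator for the sum and the product
      alike.\<close>
    have eq: "of_int (n * m) * (x + y) = of_int m * ?a + of_int n * ?b"
      "of_int (n * m) * (x * y) = ?a * ?b"
      by (simp_all add: algebra_simps)
    have int: "algebraic_int (of_int m * ?a)" "algebraic_int (of_int n * ?b)"
      using n(2) m(2) algebraic_int_of_int by blast+
    have \<tau>_scale: "\<tau> (of_int m * ?a) = of_int m * \<tau> ?a" "\<tau> (of_int n * ?b) = of_int n * \<tau> ?b"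
      using mult[OF algebraic_int_of_int n(2)] mult[OF algebraic_int_of_int m(2)] by (simp_all add: of_int)
    have "\<sigma> (x + y) = \<tau> (of_int (n * m) * (x + y)) / of_int (n * m)"
      by (rule \<sigma>[OF nm]) (unfold eq, intro algebraic_int_add int)
    also have "\<dots> = (of_int m * \<tau> ?a + of_int n * \<tau> ?b) / of_int (n * m)"
      unfolding eq by (simp only: add[OF int] \<tau>_scale)
    also have "\<dots> = \<sigma> x + \<sigma> y"
      using n(1) m(1) unfolding \<sigma>[OF n] \<sigma>[OF m] by (simp add: add_divide_distrib)
    finally have add': "\<sigma> (x + y) = \<sigma> x + \<sigma> y" .
    have "\<sigma> (x * y) = \<tau> (of_int (n * m) * (x * y)) / of_int (n * m)"
      by (rule \<sigma>[OF nm]) (unfold eq, intro algebraic_int_mult n m)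
    also have "\<dots> = \<tau> ?a * \<tau> ?b / of_int (n * m)"
      unfolding eq by (simp only: mult[OF n(2) m(2)])
    also have "\<dots> = \<sigma> x * \<sigma> y"
      unfolding \<sigma>[OF n] \<sigma>[OF m] by simp
    finally have mult': "\<sigma> (x * y) = \<sigma> x * \<sigma> y" .
    have "x = y" if "\<sigma> x = \<sigma> y"
    proof -
      have "of_int m * \<tau> ?a = of_int n * \<tau> ?b"
        using that n(1) m(1) unfolding \<sigma>[OF n] \<sigma>[OF m] by (simp add: frac_eq_eq mult.commute)
      then have "of_int m * ?a = of_int n * ?b"
        using eq_iff[OF int] unfolding \<tau>_scale by blast
      then show ?thesis
        using n(1) m(1) by (simp add: mult.left_commute)
    qed
    then show ?thesis
      using add' mult' by blast
  qed
  have \<sigma>_int: "\<sigma> x = \<tau> x" if "algebraic_int x" for x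
    using \<sigma>[of 1 x] that by simp
  have "\<sigma> 1 = 1"
    using \<sigma>_int[of 1] of_int[of 1] by simp
  then have "\<sigma> \<in> Ring.ring_hom (ring_of_type_algebra\<lparr>carrier := F\<rparr>) ring_of_type_algebra"
    unfolding ring_of_type_algebra_def using hom by (intro ring_hom_memI) simp_all
  then have "\<sigma> \<in> complex_embeddings (ring_of_type_algebra\<lparr>carrier := F\<rparr>)"
    unfolding complex_embeddings_def inj_on_def using hom by simp
  then show thesis
    using that \<sigma>_int by blast
qed

text \<open>The ultrametric inequality fails at \<open>1 + 1\<close>, whose image has absolute value
  2.\<close>

lemma absolute_value_embedding:
  assumes F: "number_field F"
    and \<sigma>: "\<sigma> \<in> complex_embeddings (ring_of_type_algebra\<lparr>carrier := F\<rparr>)"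
  shows "absolute_value F (\<lambda>x. cmod (\<sigma> x))" and "archimedean F (\<lambda>x. cmod (\<sigma> x))"
proof -
  note hom = complex_embedding_hom[OF \<sigma>] and one = complex_embedding_one[OF \<sigma>]
  have "0 \<in> F"
    using number_field_subring(2)[OF F, of 1 "- 1"] number_field_subring(1,4)[OF F] by simp
  then have zero: "\<sigma> 0 = 0"
    using hom(1)[of 0 0] by simp
  show "absolute_value F (\<lambda>x. cmod (\<sigma> x))"
    unfolding absolute_value_def
    using hom(3)[OF _ \<open>0 \<in> F\<close>] by (auto simp: hom(1,2) norm_mult norm_triangle_ineq zero)
  show "archimedean F (\<lambda>x. cmod (\<sigma> x))"
    unfolding archimedean_def
  proof
    assume *: "\<forall>x\<in>F. \<forall>y\<in>F. cmod (\<sigma> (x + y)) \<le> max (cmod (\<sigma> x)) (cmod (\<sigma> y))"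
    have "1 \<in> F" by (rule number_field_subring(1)[OF F])
    then have "cmod (\<sigma> (1 + 1)) \<le> 1"
      using *[rule_format, of 1 1] one by simp
    moreover have "\<sigma> (1 + 1) = 2"
      using hom(1)[OF \<open>1 \<in> F\<close> \<open>1 \<in> F\<close>] one by simp
    ultimately show False by simp
  qed
qed

text \<open>\<open>place_embedding\<close> may choose an embedding other than
  \<open>\<sigma>\<close>, but its absolute value is a power of that of \<open>\<sigma>\<close>.
  Both equal 2 at \<open>1 + 1\<close>, so the exponent is 1.\<close>

lemma place_of_embedding:
  fixes F :: "'a::field_char_0 set"
  assumes F: "number_field F"
    and \<sigma>: "\<sigma> \<in> complex_embeddings (ring_of_type_algebra\<lparr>carrier := F\<rparr>)"
  obtains v where "v \<in> archimedean_places F" "\<And>x. x \<in> F \<Longrightarrow> place_abs F v x = cmod (\<sigma> x)"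
proof -
  let ?w = "\<lambda>x. cmod (\<sigma> x)"
  define v where "v = {w'. absolute_value F w' \<and> equivalent_abs F ?w w'}"
  have v: "v \<in> archimedean_places F"
    unfolding archimedean_places_def v_def using absolute_value_embedding[OF F \<sigma>] by blast
  have "equivalent_abs F ?w ?w"
    unfolding equivalent_abs_def by (intro exI[of _ 1]) simp
  then have "?w \<in> v"
    unfolding v_def using absolute_value_embedding(1)[OF F \<sigma>]
    by (simp only: mem_Collect_eq simp_thms)
  define \<rho> where "\<rho> = place_embedding F v"
  have \<rho>: "\<rho> \<in> complex_embeddings (ring_of_type_algebra\<lparr>carrier := F\<rparr>) \<and> (\<lambda>x. cmod (\<rho> x)) \<in> v"
    unfolding \<rho>_def place_embedding_def
    by (rule someI[where x = \<sigma> and P = "\<lambda>\<sigma>. \<sigma> \<in> _ \<and> (\<lambda>x. cmod (\<sigma> x)) \<in> v"])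
       (rule conjI[OF \<sigma> \<open>?w \<in> v\<close>])
  then obtain s where s: "\<And>x. x \<in> F \<Longrightarrow> cmod (\<rho> x) = cmod (\<sigma> x) powr s"
    by (auto simp: v_def equivalent_abs_def)
  have "1 \<in> F" "1 + 1 \<in> F"
    using number_field_subring(1,2)[OF F] by blast+
  have two: "\<phi> (1 + 1) = 2" if "\<phi> \<in> complex_embeddings (ring_of_type_algebra\<lparr>carrier := F\<rparr>)" for \<phi>
    using complex_embedding_hom(1)[OF that \<open>1 \<in> F\<close> \<open>1 \<in> F\<close>] complex_embedding_one[OF that] by simp
  have "2 = (2::real) powr s"
    using s[OF \<open>1 + 1 \<in> F\<close>] two[OF conjunct1[OF \<rho>]] two[OF \<sigma>] by simp
  then have "s = 1"
    using powr_inj[of 2 1 s] by simp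
  then show thesis
    using that[OF v] s by (simp add: place_abs_def \<rho>_def)
qed

section \<open>Rings of algebraic integers and their ideals\<close>

lemma cring_type_algebra_restrict:
  fixes A :: "'a::field_char_0 set"
  assumes "1 \<in> A" and "\<And>x y. x \<in> A \<Longrightarrow> y \<in> A \<Longrightarrow> x + y \<in> A"
    and "\<And>x y. x \<in> A \<Longrightarrow> y \<in> A \<Longrightarrow> x * y \<in> A" and "\<And>x. x \<in> A \<Longrightarrow> - x \<in> A"
  shows "cring (ring_of_type_algebra\<lparr>carrier := A\<rparr>)"
proof -
  have "0 \<in> A"
    using assms(2)[OF assms(1) assms(4)[OF assms(1)]] by simp
  moreover have "\<exists>y\<in>A. x + y = 0 \<and> y + x = 0" if "x \<in> A" for x
    using assms(4)[OF that] by (intro bexI[of _ "- x"]) auto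
  ultimately show ?thesis
    using assms
    by unfold_locales (auto simp: ring_of_type_algebra_def algebra_simps Units_def)
qed

lemma cring_algebraic_integers: "cring (algebraic_integers :: 'a::field_char_0 ring)"
  unfolding algebraic_integers_def by (rule cring_type_algebra_restrict) auto

lemma cring_ring_of_integers:
  "number_field F \<Longrightarrow> cring (ring_of_integers F)"
  unfolding ring_of_integers_def
  by (rule cring_type_algebra_restrict) (auto intro: number_field_subring)

text \<open>The sum of the two principal ideals contains both generators, hence the ideal they
  generate, hence 1.\<close>

lemma (in cring) genideal_pair_one:
  assumes "a \<in> carrier R" "b \<in> carrier R" "Idl {a, b} = carrier R"
  obtains u v where "u \<in> carrier R" "v \<in> carrier R" "u \<otimes> a \<oplus> v \<otimes> b = \<one>"
proof -
  have zero: "\<zero> \<in> PIdl a" "\<zero> \<in> PIdl b"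
    using assms(1,2) additive_subgroup.zero_closed[OF ideal.axioms(1)[OF cgenideal_ideal]] by auto
  have "a \<in> PIdl a <+> PIdl b"
    unfolding set_add_def' using assms(1)
    by (intro UN_I[of a] UN_I[of \<zero>] cgenideal_self zero) auto
  moreover have "b \<in> PIdl a <+> PIdl b"
    unfolding set_add_def' using assms(2)
    by (intro UN_I[of \<zero>] UN_I[of b] cgenideal_self zero) auto
  ultimately have "{a, b} \<subseteq> PIdl a <+> PIdl b"
    by blast
  then have "Idl {a, b} \<subseteq> PIdl a <+> PIdl b"
    using assms by (intro genideal_minimal add_ideals cgenideal_ideal)
  then have "\<one> \<in> PIdl a <+> PIdl b"
    using assms(3) by blast
  then show thesis
    using that unfolding set_add_def' cgenideal_def by force
qed

subsection \<open>The determinant argument\<close>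

text \<open>Ideals and places are replaced here by equations with explicit cofactors and by bounds
  under embeddings, so the argument takes place among algebraic integers.\<close>

lemma small_pair_eq_0:
  fixes \<alpha> t x0 y0 x y w w0 u v :: "'a::field_char_0"
  assumes int: "algebraic_int \<alpha>" "algebraic_int t" "algebraic_int x0" "algebraic_int y0"
      "algebraic_int x" "algebraic_int y" "algebraic_int w" "algebraic_int w0"
      "algebraic_int u" "algebraic_int v"
    and "\<alpha> \<noteq> 0" and cong0: "x0 + t * y0 = w0 * \<alpha>" and cong: "x + t * y = w * \<alpha>"
    and coprime: "u * x0 + v * y0 = 1"
    and bound: "\<And>\<tau>. \<tau> \<in> complex_embeddings algebraic_integers \<Longrightarrow>
      cmod (\<tau> x0) * cmod (\<tau> y0) \<le> cmod (\<tau> \<alpha>) / 2"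
    and le: "\<And>\<tau>. \<tau> \<in> complex_embeddings algebraic_integers \<Longrightarrow>
      cmod (\<tau> x) \<le> cmod (\<tau> x0) \<and> cmod (\<tau> y) \<le> cmod (\<tau> y0)"
    and \<tau>0: "\<tau>0 \<in> complex_embeddings algebraic_integers"
    and less: "cmod (\<tau>0 x) < cmod (\<tau>0 x0) \<or> cmod (\<tau>0 y) < cmod (\<tau>0 y0)"
  shows "x = 0 \<and> y = 0"
proof -
  interpret \<tau>0: integer_embedding \<tau>0
    by unfold_locales (rule \<tau>0)
  \<comment> \<open>Eliminating \<open>x\<close> and \<open>x0\<close> from the determinant by the
    two congruences cancels \<open>t * y * y0\<close> and leaves \<open>z\<close> as cofactor of
    \<open>\<alpha>\<close>.\<close>
  define z where "z = w * y0 - w0 * y"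
  have z_int: "algebraic_int z"
    unfolding z_def diff_conv_add_uminus
    by (intro algebraic_int_add algebraic_int_minus algebraic_int_mult int)
  have det: "x * y0 - x0 * y = z * \<alpha>"
  proof -
    have "x * y0 - x0 * y = (w * \<alpha> - t * y) * y0 - (w0 * \<alpha> - t * y0) * y"
      unfolding cong[symmetric] cong0[symmetric] by simp
    also have "\<dots> = z * \<alpha>"
      by (simp add: z_def algebra_simps)
    finally show ?thesis .
  qed
  have norm_z: "cmod (\<tau> z) * cmod (\<tau> \<alpha>) \<le> cmod (\<tau> x) * cmod (\<tau> y0) + cmod (\<tau> x0) * cmod (\<tau> y)"
    if "\<tau> \<in> complex_embeddings algebraic_integers" for \<tau>
  proof -
    interpret integer_embedding \<tau>
      by unfold_locales (rule that)
    have "\<tau> z * \<tau> \<alpha> = \<tau> (x * y0 - x0 * y)"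
      unfolding det by (rule mult[OF z_int int(1), symmetric])
    also have "\<dots> = \<tau> x * \<tau> y0 - \<tau> x0 * \<tau> y"
      using diff[OF algebraic_int_mult[OF int(5,4)] algebraic_int_mult[OF int(3,6)]]
        mult[OF int(5,4)] mult[OF int(3,6)] by (simp only:)
    finally show ?thesis
      using norm_triangle_ineq4[of "\<tau> x * \<tau> y0" "\<tau> x0 * \<tau> y"] by (simp only: norm_mult[symmetric])
  qed
  have pos: "cmod (\<tau> a) > 0"
    if "\<tau> \<in> complex_embeddings algebraic_integers" "algebraic_int a" "a \<noteq> 0" for \<tau> a
    using integer_embedding.eq_0_iff[of \<tau> a] that by (simp add: integer_embedding_def)
  have eq: "x * y0 = x0 * y"
  \<comment> \<open>If \<open>x0\<close> or \<open>y0\<close> is 0, strictness in the estimate may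
    be lost; but then \<open>x\<close> or \<open>y\<close> respectively is 0 as well, and both sides
    vanish.\<close>
  proof (cases "x0 = 0 \<or> y0 = 0")
    case True
    then have "cmod (\<tau>0 x) \<le> 0 \<and> x0 = 0 \<or> cmod (\<tau>0 y) \<le> 0 \<and> y0 = 0"
      using le[OF \<tau>0] \<tau>0.zero by auto
    then show ?thesis
      using \<tau>0.eq_0_iff[OF int(5)] \<tau>0.eq_0_iff[OF int(6)] by auto
  next
    case False
    have "z = 0"
    proof (rule algebraic_int_eq_0I[OF z_int _ \<tau>0])
      fix \<tau> :: "'a \<Rightarrow> complex" assume \<tau>: "\<tau> \<in> complex_embeddings algebraic_integers"
      have "cmod (\<tau> x) * cmod (\<tau> y0) + cmod (\<tau> x0) * cmod (\<tau> y)
          \<le> cmod (\<tau> x0) * cmod (\<tau> y0) + cmod (\<tau> x0) * cmod (\<tau> y0)"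
        using le[OF \<tau>] by (intro add_mono mult_right_mono mult_left_mono) auto
      then have "cmod (\<tau> z) * cmod (\<tau> \<alpha>) \<le> 1 * cmod (\<tau> \<alpha>)"
        using norm_z[OF \<tau>] bound[OF \<tau>] by simp
      then show "cmod (\<tau> z) \<le> 1"
        using pos[OF \<tau> int(1) \<open>\<alpha> \<noteq> 0\<close>] by (simp only: mult_le_cancel_right_pos)
    next
      \<comment> \<open>Positivity keeps the given strict inequality strict after
        multiplication.\<close>
      have x0y0: "cmod (\<tau>0 x0) > 0" "cmod (\<tau>0 y0) > 0"
        using pos[OF \<tau>0] int(3,4) False by auto
      have "cmod (\<tau>0 x) * cmod (\<tau>0 y0) + cmod (\<tau>0 x0) * cmod (\<tau>0 y)
          < cmod (\<tau>0 x0) * cmod (\<tau>0 y0) + cmod (\<tau>0 x0) * cmod (\<tau>0 y0)"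
        using less
      proof
        assume "cmod (\<tau>0 x) < cmod (\<tau>0 x0)"
        then show ?thesis
          using le[OF \<tau>0] x0y0 by (intro add_less_le_mono mult_strict_right_mono mult_left_mono) auto
      next
        assume "cmod (\<tau>0 y) < cmod (\<tau>0 y0)"
        then show ?thesis
          using le[OF \<tau>0] x0y0 by (intro add_le_less_mono mult_right_mono mult_strict_left_mono) auto
      qed
      then have "cmod (\<tau>0 z) * cmod (\<tau>0 \<alpha>) < 1 * cmod (\<tau>0 \<alpha>)"
        using norm_z[OF \<tau>0] bound[OF \<tau>0] by simp
      then show "cmod (\<tau>0 z) < 1"
        using pos[OF \<tau>0 int(1) \<open>\<alpha> \<noteq> 0\<close>] by (simp only: mult_less_cancel_right_pos)
    qed
    then show ?thesis
      using det by simp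
  qed
  \<comment> \<open>By \<open>eq\<close> the two pairs are proportional; the Bezout coefficients
    express the ratio without division, so it is integral.\<close>
  define e where "e = u * x + v * y"
  have e_int: "algebraic_int e"
    unfolding e_def by (intro algebraic_int_add algebraic_int_mult int)
  have x: "x = x0 * e"
  proof -
    have "x = (u * x0 + v * y0) * x"
      by (simp add: coprime)
    also have "\<dots> = u * x0 * x + v * (x * y0)"
      by (simp add: algebra_simps)
    also have "\<dots> = x0 * e"
      unfolding eq by (simp add: e_def algebra_simps)
    finally show ?thesis .
  qed
  have y: "y = y0 * e"
  proof -
    have "y = (u * x0 + v * y0) * y"
      by (simp add: coprime)
    also have "\<dots> = u * (x0 * y) + v * y0 * y"
      by (simp add: algebra_simps)
    also have "\<dots> = y0 * e"
      unfolding eq[symmetric] by (simp add: e_def algebra_simps)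
    finally show ?thesis .
  qed
  have norm_e: "cmod (\<tau> x) = cmod (\<tau> x0) * cmod (\<tau> e)" "cmod (\<tau> y) = cmod (\<tau> y0) * cmod (\<tau> e)"
    if "\<tau> \<in> complex_embeddings algebraic_integers" for \<tau>
  proof -
    interpret integer_embedding \<tau>
      by unfold_locales (rule that)
    show "cmod (\<tau> x) = cmod (\<tau> x0) * cmod (\<tau> e)" "cmod (\<tau> y) = cmod (\<tau> y0) * cmod (\<tau> e)"
      unfolding x y using mult[OF int(3) e_int] mult[OF int(4) e_int] by (simp_all only: norm_mult)
  qed
  have "e = 0"
  proof (rule algebraic_int_eq_0I[OF e_int _ \<tau>0])
    fix \<tau> :: "'a \<Rightarrow> complex" assume \<tau>: "\<tau> \<in> complex_embeddings algebraic_integers"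
    \<comment> \<open>A nonzero coordinate can be cancelled in \<open>norm_e\<close>.\<close>
    have "x0 \<noteq> 0 \<or> y0 \<noteq> 0"
      using coprime by auto
    then show "cmod (\<tau> e) \<le> 1"
      using le[OF \<tau>] norm_e[OF \<tau>] pos[OF \<tau> int(3)] pos[OF \<tau> int(4)]
      by (auto simp: mult_le_cancel_left1)
  next
    \<comment> \<open>The strict inequality itself forces the factor to be cancelled to be
      positive.\<close>
    show "cmod (\<tau>0 e) < 1"
      using less norm_e[OF \<tau>0] by (auto simp: mult_less_cancel_left2)
  qed
  then show ?thesis
    by (simp add: x y)
qed

section \<open>From ideals and places to equations and embeddings\<close>

theorem theorem4p3:
  fixes F J :: "'a::{alg_closed_field, field_char_0} set"
    and \<O>\<^sub>F Zbar :: "'a ring"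
    and \<alpha> t x0 y0 :: 'a
  defines "\<O>\<^sub>F \<equiv> ring_of_integers F"
    and "Zbar \<equiv> algebraic_integers"
  assumes "number_field F"
    and "\<alpha> \<in> carrier \<O>\<^sub>F"
    and "J = PIdl\<^bsub>\<O>\<^sub>F\<^esub> \<alpha>"
    and "J \<noteq> {0}"
    and "t \<in> carrier \<O>\<^sub>F"
    and "J <+>\<^bsub>\<O>\<^sub>F\<^esub> (PIdl\<^bsub>\<O>\<^sub>F\<^esub> t) = carrier \<O>\<^sub>F"
    and "x0 \<in> carrier \<O>\<^sub>F" and "y0 \<in> carrier \<O>\<^sub>F"
    and "x0 + t * y0 \<in> J"
    and "\<forall>v\<in>archimedean_places F. place_abs F v (x0 * y0) \<le> place_abs F v \<alpha> / 2"
    and "Idl\<^bsub>\<O>\<^sub>F\<^esub> {x0, y0} = carrier \<O>\<^sub>F"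
    and "Idl\<^bsub>\<O>\<^sub>F\<^esub> {x0, \<alpha>} = carrier \<O>\<^sub>F"
    and "Idl\<^bsub>\<O>\<^sub>F\<^esub> {y0, \<alpha>} = carrier \<O>\<^sub>F"
  shows "\<not> (\<exists>x\<in>carrier Zbar. \<exists>y\<in>carrier Zbar.
           (x, y) \<noteq> (0, 0) \<and>
           x + t * y \<in> Idl\<^bsub>Zbar\<^esub> J \<and>
           (\<forall>\<tau>\<in>complex_embeddings Zbar. cmod (\<tau> x) \<le> cmod (\<tau> x0) \<and> cmod (\<tau> y) \<le> cmod (\<tau> y0)) \<and>
           (\<exists>\<tau>\<in>complex_embeddings Zbar. cmod (\<tau> x) < cmod (\<tau> x0) \<or> cmod (\<tau> y) < cmod (\<tau> y0)))"
proof
  assume "\<exists>x\<in>carrier Zbar. \<exists>y\<in>carrier Zbar.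
           (x, y) \<noteq> (0, 0) \<and>
           x + t * y \<in> Idl\<^bsub>Zbar\<^esub> J \<and>
           (\<forall>\<tau>\<in>complex_embeddings Zbar. cmod (\<tau> x) \<le> cmod (\<tau> x0) \<and> cmod (\<tau> y) \<le> cmod (\<tau> y0)) \<and>
           (\<exists>\<tau>\<in>complex_embeddings Zbar. cmod (\<tau> x) < cmod (\<tau> x0) \<or> cmod (\<tau> y) < cmod (\<tau> y0))"
  then obtain x y \<tau>0 where xy: "x \<in> carrier Zbar" "y \<in> carrier Zbar" "(x, y) \<noteq> (0, 0)"
    and x_ty: "x + t * y \<in> Idl\<^bsub>Zbar\<^esub> J"
    and le: "\<forall>\<tau>\<in>complex_embeddings Zbar. cmod (\<tau> x) \<le> cmod (\<tau> x0) \<and> cmod (\<tau> y) \<le> cmod (\<tau> y0)"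
    and \<tau>0: "\<tau>0 \<in> complex_embeddings Zbar"
      "cmod (\<tau>0 x) < cmod (\<tau>0 x0) \<or> cmod (\<tau>0 y) < cmod (\<tau>0 y0)"
    by blast
  note F = \<open>number_field F\<close>
  have carr: "a \<in> carrier \<O>\<^sub>F \<longleftrightarrow> a \<in> F \<and> algebraic_int a" "a \<in> carrier Zbar \<longleftrightarrow> algebraic_int a" for a
    by (simp_all add: \<O>\<^sub>F_def Zbar_def ring_of_integers_def algebraic_integers_def)
  have ops: "a \<otimes>\<^bsub>\<O>\<^sub>F\<^esub> b = a * b" "a \<oplus>\<^bsub>\<O>\<^sub>F\<^esub> b = a + b" "\<one>\<^bsub>\<O>\<^sub>F\<^esub> = 1" "a \<otimes>\<^bsub>Zbar\<^esub> b = a * b" for a b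
    by (simp_all add: \<O>\<^sub>F_def Zbar_def ring_of_integers_def algebraic_integers_def ring_of_type_algebra_def)
  interpret O: cring \<O>\<^sub>F
    unfolding \<O>\<^sub>F_def by (rule cring_ring_of_integers[OF F])
  interpret Z: cring Zbar
    unfolding Zbar_def by (rule cring_algebraic_integers)
  have int: "algebraic_int \<alpha>" "algebraic_int t" "algebraic_int x0" "algebraic_int y0"
    and in_F: "\<alpha> \<in> F" "x0 \<in> F" "y0 \<in> F"
    using \<open>\<alpha> \<in> carrier \<O>\<^sub>F\<close> \<open>t \<in> carrier \<O>\<^sub>F\<close> \<open>x0 \<in> carrier \<O>\<^sub>F\<close> \<open>y0 \<in> carrier \<O>\<^sub>F\<close> carr by auto
  have J: "J = {w * \<alpha> | w. w \<in> F \<and> algebraic_int w}"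
    unfolding \<open>J = PIdl\<^bsub>\<O>\<^sub>F\<^esub> \<alpha>\<close> cgenideal_def by (simp add: carr ops)
  have "\<alpha> \<noteq> 0"
  proof
    assume "\<alpha> = 0"
    then have "J = {0}"
      unfolding J using number_field_subring(1)[OF F] by auto
    then show False
      using \<open>J \<noteq> {0}\<close> by contradiction
  qed
  obtain w0 where w0: "algebraic_int w0" "x0 + t * y0 = w0 * \<alpha>"
    using \<open>x0 + t * y0 \<in> J\<close> unfolding J by blast
  have PIdl_Z: "PIdl\<^bsub>Zbar\<^esub> \<alpha> = {w * \<alpha> | w. algebraic_int w}"
    unfolding cgenideal_def by (simp add: carr ops)
  \<comment> \<open>The multiples of \<open>\<alpha>\<close> in \<open>Zbar\<close> form an ideal
    containing \<open>J\<close>, so the second congruence also has an explicit cofactor.\<close>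
  have "Idl\<^bsub>Zbar\<^esub> J \<subseteq> PIdl\<^bsub>Zbar\<^esub> \<alpha>"
  proof (rule Z.genideal_minimal)
    show "ideal (PIdl\<^bsub>Zbar\<^esub> \<alpha>) Zbar"
      using int(1) carr by (intro Z.cgenideal_ideal) simp
    show "J \<subseteq> PIdl\<^bsub>Zbar\<^esub> \<alpha>"
      unfolding J PIdl_Z by blast
  qed
  then obtain w where w: "algebraic_int w" "x + t * y = w * \<alpha>"
    using x_ty unfolding PIdl_Z by blast
  obtain u v where uv: "algebraic_int u" "algebraic_int v" "u * x0 + v * y0 = 1"
    using O.genideal_pair_one[OF \<open>x0 \<in> carrier \<O>\<^sub>F\<close> \<open>y0 \<in> carrier \<O>\<^sub>F\<close> \<open>Idl\<^bsub>\<O>\<^sub>F\<^esub> {x0, y0} = carrier \<O>\<^sub>F\<close>]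
    unfolding carr ops by blast
  \<comment> \<open>The extension of \<open>\<tau>\<close> to \<open>F\<close> induces an
    archimedean place, where the hypothesis on \<open>x0 * y0\<close> applies.\<close>
  have bound: "cmod (\<tau> x0) * cmod (\<tau> y0) \<le> cmod (\<tau> \<alpha>) / 2"
    if \<tau>: "\<tau> \<in> complex_embeddings algebraic_integers" for \<tau>
  proof -
    obtain \<sigma> where \<sigma>: "\<sigma> \<in> complex_embeddings (ring_of_type_algebra\<lparr>carrier := F\<rparr>)"
      and \<sigma>_int: "\<And>x. algebraic_int x \<Longrightarrow> \<sigma> x = \<tau> x"
      using extend_embedding_number_field[OF F \<tau>] by metis
    obtain v where v: "v \<in> archimedean_places F" "\<And>x. x \<in> F \<Longrightarrow> place_abs F v x = cmod (\<sigma> x)"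
      using place_of_embedding[OF F \<sigma>] by metis
    have "place_abs F v (x0 * y0) \<le> place_abs F v \<alpha> / 2"
      using \<open>\<forall>v\<in>archimedean_places F. place_abs F v (x0 * y0) \<le> place_abs F v \<alpha> / 2\<close> v(1) by blast
    then show ?thesis
      unfolding v(2)[OF number_field_subring(3)[OF F in_F(2,3)]] v(2)[OF in_F(1)]
        complex_embedding_hom(2)[OF \<sigma> in_F(2,3)] norm_mult \<sigma>_int[OF int(1)] \<sigma>_int[OF int(3)] \<sigma>_int[OF int(4)] .
  qed
  have xy_int: "algebraic_int x" "algebraic_int y"
    using xy(1,2) carr(2) by auto
  have "x = 0 \<and> y = 0"
  proof (rule small_pair_eq_0[OF int xy_int w(1) w0(1) uv(1,2) \<open>\<alpha> \<noteq> 0\<close> w0(2) w(2) uv(3)])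
    show "cmod (\<tau> x0) * cmod (\<tau> y0) \<le> cmod (\<tau> \<alpha>) / 2"
      if "\<tau> \<in> complex_embeddings algebraic_integers" for \<tau>
      by (rule bound[OF that])
    show "cmod (\<tau> x) \<le> cmod (\<tau> x0) \<and> cmod (\<tau> y) \<le> cmod (\<tau> y0)"
      if "\<tau> \<in> complex_embeddings algebraic_integers" for \<tau>
      using le that unfolding Zbar_def by blast
    show "\<tau>0 \<in> complex_embeddings algebraic_integers"
      using \<tau>0(1) unfolding Zbar_def .
    show "cmod (\<tau>0 x) < cmod (\<tau>0 x0) \<or> cmod (\<tau>0 y) < cmod (\<tau>0 y0)"
      by (rule \<tau>0(2))
  qed
  then show False
    using xy(3) by simp
qed

end
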